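(* Let $\ell\ge7$ and $n\ge15\ell-60$ be integers. If $G$ is an oriented graph on $n$ vertices with $\delta^0(G)\ge\lfloor n/3\rfloor+1$, then every vertex of $G$ lies on a copy of $C_\ell$ in $G$.
   Context: An oriented graph is an orientation of a (finite) simple graph: no loops, and at most one arc on each unordered pair of vertices. $\delta^0(G)=\min_{v}\min\{d^+(v),d^-(v)\}$ is the minimum semidegree. $C_\ell$ denotes the consistently oriented (directed) cycle of length $\ell$ (with $\ell$ distinct vertices). *)

theory Defs
  imports "Graph_Theory.Arc_Walk"
begin

text \<open>The locale \<^locale>\<open>digraph\<close> gives a finite digraph without loops and without parallel arcs;
  excluding antiparallel arcs leaves at most one arc on each unordered pair of vertices.\<close>

locale oriented_graph = digraph +
  assumes no_antiparallel_arcs: "u \<rightarrow>\<^bsub>G\<^esub> v \<Longrightarrow> \<not> v \<rightarrow>\<^bsub>G\<^esub> u"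

text \<open>Only meaningful for a digraph with a finite, nonempty vertex set.\<close>

definition min_semidegree :: "('a, 'b) pre_digraph \<Rightarrow> nat" where
  "min_semidegree G = Min ((\<lambda>v. min (out_degree G v) (in_degree G v)) ` verts G)"

text \<open>A copy of the directed cycle of length \<open>l\<close> is given by its list of \<open>l\<close> arcs; since the walk
  is closed, the tails of the arcs are exactly the vertices of the cycle.\<close>

definition lies_on_directed_cycle :: "('a, 'b) pre_digraph \<Rightarrow> nat \<Rightarrow> 'a \<Rightarrow> bool" where
  "lies_on_directed_cycle G l v \<longleftrightarrow>
     (\<exists>p. pre_digraph.cycle G p \<and> length p = l \<and> v \<in> tail G ` set p)"

end

theory Submission
  imports Defs
begin

text \<open>A vertex \<open>v\<close> starts a transitive triangle \<open>v, q, r\<close>, and \<open>r\<close> starts another one \<open>r, q', r'\<close>: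
  for an arc from \<open>v\<close> to \<open>w\<close>, the out-neighbourhoods of \<open>v\<close> and \<open>w\<close> and the
  in-neighbourhood of \<open>w\<close> are too large to be pairwise disjoint. This gives
  \<open>v\<close>-\<open>r'\<close> paths of lengths 2, 3 and 4. Extend them greedily from \<open>r'\<close> by \<open>l - 7\<close> arcs to a
  vertex \<open>x\<close>. What remains after deleting the \<open>l - 4\<close> used vertices other than \<open>x\<close> and \<open>v\<close> has
  minimum semidegree more than \<open>2/7\<close> of its order, which forces an \<open>x\<close>-\<open>v\<close> path of length 3, 4
  or 5; whichever it is, one of the three initial paths brings the total to \<open>l\<close>.

  For that path, let \<open>A\<close> and \<open>B\<close> be the out-neighbours of \<open>x\<close> and the in-neighbours of \<open>y = v\<close>,
  and \<open>S\<close> and \<open>T\<close> the further out- and in-neighbours of \<open>A\<close> and \<open>B\<close>. Without short paths,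
  all arcs out of \<open>S\<close> end in \<open>A - B\<close>, in \<open>S\<close> or outside \<open>A \<union> B \<union> S \<union> T\<close>, apart from
  degenerate arcs to \<open>T\<close>. If \<open>S\<close> is no larger than \<open>T\<close>, counting the arcs out of \<open>A\<close> and \<open>S\<close>
  yields more vertices than there are; otherwise reverse all arcs.\<close>

section \<open>Counting arcs between vertex sets\<close>

definition num_arcs :: "'a rel \<Rightarrow> 'a set \<Rightarrow> 'a set \<Rightarrow> nat" where
  "num_arcs E X Y = card (E \<inter> X \<times> Y)"

lemma num_arcs_converse: "num_arcs (E\<inverse>) X Y = num_arcs E Y X"
proof -
  have "E\<inverse> \<inter> X \<times> Y = (E \<inter> Y \<times> X)\<inverse>" by auto
  then show ?thesis unfolding num_arcs_def by (metis card_inverse)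
qed

lemma num_arcs_Un_le: "num_arcs E X (Y \<union> Z) \<le> num_arcs E X Y + num_arcs E X Z"
proof -
  have "E \<inter> X \<times> (Y \<union> Z) = (E \<inter> X \<times> Y) \<union> (E \<inter> X \<times> Z)" by auto
  then show ?thesis unfolding num_arcs_def by (metis card_Un_le)
qed

lemma num_arcs_le: "finite X \<Longrightarrow> finite Y \<Longrightarrow> num_arcs E X Y \<le> card X * card Y"
  unfolding num_arcs_def card_cartesian_product[symmetric] by (intro card_mono) auto

lemma num_arcs_swap_le:
  assumes "finite X" "finite Y" and asym: "\<And>u v. (u, v) \<in> E \<Longrightarrow> (v, u) \<notin> E"
  shows "num_arcs E X Y + num_arcs E Y X \<le> card X * card Y"
proof -
  have "num_arcs E X Y + num_arcs E Y X = card (E \<inter> X \<times> Y) + card (E\<inverse> \<inter> X \<times> Y)"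
    using num_arcs_converse[of E X Y] by (simp add: num_arcs_def)
  also have "\<dots> = card ((E \<inter> X \<times> Y) \<union> (E\<inverse> \<inter> X \<times> Y))"
    using assms by (intro card_Un_disjoint[symmetric]) auto
  also have "\<dots> \<le> card (X \<times> Y)" using assms(1,2) by (intro card_mono) auto
  finally show ?thesis by (simp add: card_cartesian_product)
qed

text \<open>Inside \<open>X \<times> X\<close> the relation, its converse and the diagonal are
  disjoint; \<open>asym\<close> also excludes loops.\<close>

lemma num_arcs_self_le:
  assumes "finite X" and asym: "\<And>u v. (u, v) \<in> E \<Longrightarrow> (v, u) \<notin> E"
  shows "2 * num_arcs E X X + card X \<le> card X * card X"
proof -
  have "2 * num_arcs E X X + card X
      = card (E \<inter> X \<times> X) + card (E\<inverse> \<inter> X \<times> X) + card (Id_on X)"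
    using num_arcs_converse[of E X X] by (simp add: num_arcs_def Id_on_def UNION_singleton_eq_range
      card_image inj_on_def)
  also have "\<dots> = card ((E \<inter> X \<times> X) \<union> (E\<inverse> \<inter> X \<times> X)) + card (Id_on X)"
    using assms by (subst card_Un_disjoint) auto
  also have "\<dots> = card ((E \<inter> X \<times> X) \<union> (E\<inverse> \<inter> X \<times> X) \<union> Id_on X)"
    using assms by (intro card_Un_disjoint[symmetric] finite_subset[of "Id_on X" "X \<times> X"]) auto
  also have "\<dots> \<le> card (X \<times> X)" using assms(1) by (intro card_mono) auto
  finally show ?thesis by (simp add: card_cartesian_product)
qed

lemma num_arcs_eq_sum:
  assumes "finite X" "finite Y"
  shows "num_arcs E X Y = (\<Sum>u\<in>X. card (E `` {u} \<inter> Y))"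
proof -
  have "E \<inter> X \<times> Y = (SIGMA u:X. E `` {u} \<inter> Y)" by auto
  then show ?thesis unfolding num_arcs_def using assms by (simp add: card_SigmaI)
qed

lemma num_arcs_ge:
  assumes "finite X" "finite Y" "\<And>u. u \<in> X \<Longrightarrow> d \<le> card (E `` {u} \<inter> Y)"
  shows "card X * d \<le> num_arcs E X Y"
  using sum_bounded_below[of X d "\<lambda>u. card (E `` {u} \<inter> Y)"] assms
  by (simp add: num_arcs_eq_sum)

section \<open>Structure forced by the absence of short paths\<close>

text \<open>In the application, \<open>A\<close> and \<open>B\<close> are the neighbourhoods of \<open>x\<close> and \<open>y\<close> trimmed to equal
  size. The trimming keeps \<open>A \<inter> B\<close> as large as possible, whence \<open>A_y\<close> and \<open>x_B\<close>; the bound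
  \<open>card_A_ge\<close> leaves room for an arc from \<open>x\<close> to \<open>y\<close>.\<close>

locale no_short_path =
  fixes V :: "'a set" and E :: "'a rel" and x y :: 'a and A B :: "'a set" and d :: nat
  assumes finite_V: "finite V" and x_V: "x \<in> V" and y_V: "y \<in> V" and x_y: "x \<noteq> y"
    and asym: "\<And>u v. (u, v) \<in> E \<Longrightarrow> (v, u) \<notin> E"
    and outdeg: "\<And>u. u \<in> V \<Longrightarrow> d \<le> card (E `` {u} \<inter> V)"
    and indeg: "\<And>u. u \<in> V \<Longrightarrow> d \<le> card (E\<inverse> `` {u} \<inter> V)"
    and A: "A \<subseteq> E `` {x} \<inter> V - {y}" and B: "B \<subseteq> E\<inverse> `` {y} \<inter> V - {x}"
    and card_A_B: "card A = card B" and card_A_le: "card A \<le> d" and card_A_ge: "d \<le> card A + 1"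
    and A_y: "\<And>a. a \<in> A - B \<Longrightarrow> (a, y) \<notin> E" and x_B: "\<And>b. b \<in> B - A \<Longrightarrow> (x, b) \<notin> E"
    and no_path3: "\<And>a b. \<lbrakk>(x, a) \<in> E; (a, b) \<in> E; (b, y) \<in> E; {a, b} \<subseteq> V - {x, y}\<rbrakk> \<Longrightarrow> False"
    and no_path4: "\<And>a c b. \<lbrakk>(x, a) \<in> E; (a, c) \<in> E; (c, b) \<in> E; (b, y) \<in> E;
      {a, c, b} \<subseteq> V - {x, y}\<rbrakk> \<Longrightarrow> False"
    and no_path5: "\<And>a c c' b. \<lbrakk>(x, a) \<in> E; (a, c) \<in> E; (c, c') \<in> E; (c', b) \<in> E; (b, y) \<in> E;
      {a, c, c', b} \<subseteq> V - {x, y}; a \<noteq> b\<rbrakk> \<Longrightarrow> False"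
begin

definition S where "S = {c \<in> V - A - {y}. \<exists>a\<in>A. (a, c) \<in> E}"

text \<open>The vertices of \<open>S1\<close> may have arcs to \<open>T\<close>: the resulting walk of length 5 from \<open>x\<close> to \<open>y\<close>
  could pass through the same vertex of \<open>A \<inter> B\<close> twice.\<close>

definition S1 where "S1 = {c \<in> S. \<exists>a\<in>A \<inter> B. E\<inverse> `` {c} \<inter> A = {a}}"
definition S2 where "S2 = S - S1"
definition T where "T = {c \<in> V - B - {x}. \<exists>b\<in>B. (c, b) \<in> E}"

lemma rev: "no_short_path V (E\<inverse>) y x B A d"
proof unfold_locales
  show "{a, c, c', b} \<subseteq> V - {y, x} \<Longrightarrow> (y, a) \<in> E\<inverse> \<Longrightarrow> (a, c) \<in> E\<inverse> \<Longrightarrow> (c, c') \<in> E\<inverse> \<Longrightarrow>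
    (c', b) \<in> E\<inverse> \<Longrightarrow> (b, x) \<in> E\<inverse> \<Longrightarrow> a \<noteq> b \<Longrightarrow> False" for a c c' b
    using no_path5[of b c' c a] by auto
  show "{a, c, b} \<subseteq> V - {y, x} \<Longrightarrow> (y, a) \<in> E\<inverse> \<Longrightarrow> (a, c) \<in> E\<inverse> \<Longrightarrow> (c, b) \<in> E\<inverse> \<Longrightarrow>
    (b, x) \<in> E\<inverse> \<Longrightarrow> False" for a c b
    using no_path4[of b c a] by auto
  show "{a, b} \<subseteq> V - {y, x} \<Longrightarrow> (y, a) \<in> E\<inverse> \<Longrightarrow> (a, b) \<in> E\<inverse> \<Longrightarrow>
    (b, x) \<in> E\<inverse> \<Longrightarrow> False" for a b
    using no_path3[of b a] by auto
qed (use finite_V x_V y_V x_y asym outdeg indeg A B card_A_B card_A_le card_A_ge A_y x_B in auto)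

lemma A_facts: "a \<in> A \<Longrightarrow> (x, a) \<in> E \<and> a \<in> V - {x, y}"
  using A asym[of x x] by auto

lemma B_facts: "b \<in> B \<Longrightarrow> (b, y) \<in> E \<and> b \<in> V - {x, y}"
  using B asym[of y y] by auto

text \<open>A vertex of \<open>B\<close> in \<open>S\<close> would complete a path of length 3; an
  arc from \<open>A\<close> to \<open>x\<close> would be antiparallel.\<close>

lemma S_facts: "c \<in> S \<Longrightarrow> c \<in> V - A - B - {x, y}"
  using A_facts B_facts asym no_path3 unfolding S_def by fastforce

lemma T_facts: "c \<in> T \<Longrightarrow> c \<in> V - A - B - {x, y}"
  using A_facts B_facts asym no_path3 unfolding T_def by fastforce

lemma S_T_disjoint: "S \<inter> T = {}"
proof -
  have False if "c \<in> S" "c \<in> T" for c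
  proof -
    obtain a b where ab: "a \<in> A" "(a, c) \<in> E" "b \<in> B" "(c, b) \<in> E"
      using \<open>c \<in> S\<close> \<open>c \<in> T\<close> unfolding S_def T_def by blast
    show False using no_path4[of a c b] ab A_facts[of a] B_facts[of b] S_facts[of c] that by auto
  qed
  then show ?thesis by auto
qed

lemma finite_sets: "finite A" "finite B" "finite S" "finite S1" "finite S2" "finite T"
  using A B finite_V unfolding S2_def S1_def S_def T_def by (auto intro: finite_subset)

text \<open>\<open>S1\<close> is counted here, because its vertices may send arcs to
  \<open>T\<close>.\<close>

definition R where "R = V - (A \<union> B \<union> S2 \<union> T)"

lemma R_xy: "x \<in> R" "y \<in> R"
  using x_V y_V A_facts B_facts S_facts T_facts unfolding R_def S2_def by auto

lemma S1_subset_R: "S1 \<subseteq> R - {x, y}"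
  using S_facts S_T_disjoint unfolding R_def S2_def S1_def by auto

text \<open>An arc to \<open>y\<close>, \<open>B\<close> or \<open>T\<close> would complete a path
  of length 3, 4 or 5, respectively.\<close>

lemma out_S2: assumes "c \<in> S2" shows "E `` {c} \<inter> V \<subseteq> (A - B) \<union> S2 \<union> (R - {y})"
proof -
  have cS: "c \<in> S" using assms S2_def by auto
  obtain a where a: "a \<in> A" "(a, c) \<in> E" using cS S_def by auto
  have c: "c \<in> V - A - B - {x, y}" using S_facts[OF cS] .
  have "z \<notin> B" if "(c, z) \<in> E" for z
    using no_path4[of a c z] a that A_facts[of a] B_facts[of z] c by auto
  moreover have "z \<notin> T" if z: "(c, z) \<in> E" for z
  proof
    assume zT: "z \<in> T"
    then obtain b where b: "b \<in> B" "(z, b) \<in> E" unfolding T_def by auto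
    \<comment> \<open>\<open>no_path5\<close> needs distinct ends. If \<open>a = b\<close>, this
      vertex lies in \<open>A \<inter> B\<close>, and \<open>c\<close>, not being in
      \<open>S1\<close>, has another in-neighbour in \<open>A\<close>.\<close>
    obtain a' where a': "a' \<in> A" "(a', c) \<in> E" "a' \<noteq> b"
    proof (cases "a = b")
      case True
      then have "E\<inverse> `` {c} \<inter> A \<noteq> {a}" using assms a b unfolding S2_def S1_def by blast
      then show ?thesis using a that True by blast
    qed (use a that in auto)
    show False
      using no_path5[of a' c z b] a' b z A_facts[of a'] B_facts[of b] c T_facts[OF zT] by auto
  qed
  moreover have "(c, y) \<notin> E" using no_path3[of a c] a A_facts[of a] c by auto
  ultimately show ?thesis unfolding R_def by blast
qed

lemma out_A: assumes "a \<in> A" shows "E `` {a} \<inter> V \<subseteq> (A - B) \<union> S \<union> {y}"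
proof -
  have "z \<notin> B" if "(a, z) \<in> E" for z
    using no_path3[of a z] assms that A_facts[of a] B_facts[of z] by auto
  then show ?thesis using assms unfolding S_def by auto
qed

text \<open>The only in-neighbour in \<open>A\<close> of a vertex of \<open>S1\<close> lies in
  \<open>B\<close>, and \<open>A_y\<close> rules out \<open>y\<close>.\<close>

lemma out_A_minus_B: assumes "a \<in> A - B" shows "E `` {a} \<inter> V \<subseteq> (A - B) \<union> S2"
proof -
  have "z \<notin> S1" if "(a, z) \<in> E" for z
  proof
    assume "z \<in> S1"
    then obtain a' where "a' \<in> A \<inter> B" "E\<inverse> `` {z} \<inter> A = {a'}" unfolding S1_def by auto
    moreover have "a \<in> E\<inverse> `` {z} \<inter> A" using that assms by auto
    ultimately show False using assms by auto
  qed
  then show ?thesis using out_A[of a] A_y[of a] assms unfolding S2_def by auto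
qed

text \<open>By \<open>card_A_B\<close>, the first two terms together count
  \<open>A \<union> B\<close>.\<close>

lemma card_V: "card V = card A + card (A - B) + card S2 + card T + card R"
proof -
  have "card (A \<union> B) = card A + card (B - A)"
    using card_Un_disjoint[of A "B - A"] finite_sets by simp
  moreover have "card (B - A) = card (A - B)"
    using card_A_B card_Int_Diff[of A B] card_Int_Diff[of B A] finite_sets by (simp add: Int_commute)
  moreover have "card (A \<union> B \<union> S2) = card (A \<union> B) + card S2"
    using finite_sets S_facts unfolding S2_def by (intro card_Un_disjoint) auto
  moreover have "card (A \<union> B \<union> S2 \<union> T) = card (A \<union> B \<union> S2) + card T"
    using finite_sets T_facts S_T_disjoint unfolding S2_def by (intro card_Un_disjoint) auto
  moreover have "card V = card (A \<union> B \<union> S2 \<union> T) + card R"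
    using finite_sets finite_V S_facts T_facts A B unfolding R_def S2_def
    by (subst card_Diff_subset) (auto intro!: le_add_diff_inverse[symmetric] card_mono)
  ultimately show ?thesis by linarith
qed

lemma finite_R: "finite R" using finite_V R_def by auto

section \<open>Counting the arcs out of \<open>A\<close> and \<open>S2\<close>\<close>

lemma arcs_A_minus_B:
  "card (A - B) * d \<le> num_arcs E (A - B) (A - B) + num_arcs E (A - B) S2"
proof -
  have "card (A - B) * d \<le> num_arcs E (A - B) ((A - B) \<union> S2)"
    using finite_sets finite_V A_facts out_A_minus_B
    by (intro num_arcs_ge order_trans[OF outdeg] card_mono) auto
  then show ?thesis using num_arcs_Un_le order_trans by blast
qed

text \<open>The \<open>- 1\<close> is due to \<open>y\<close>, which lies in \<open>R\<close> but
  receives no arc from \<open>S2\<close>.\<close>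

lemma arcs_S2:
  "card S2 * d \<le> num_arcs E S2 (A - B) + num_arcs E S2 S2 + card S2 * (card R - 1)"
proof -
  have "card S2 * d \<le> num_arcs E S2 ((A - B) \<union> S2 \<union> (R - {y}))"
    using finite_sets finite_V S_facts out_S2 finite_R
    by (intro num_arcs_ge order_trans[OF outdeg] card_mono) (auto simp: S2_def)
  also have "\<dots> \<le> num_arcs E S2 ((A - B) \<union> S2) + num_arcs E S2 (R - {y})"
    by (rule num_arcs_Un_le)
  also have "\<dots> \<le> num_arcs E S2 (A - B) + num_arcs E S2 S2 + card S2 * card (R - {y})"
    using num_arcs_Un_le[of E S2 "A - B" S2] num_arcs_le[of S2 "R - {y}" E] finite_sets finite_R
    by simp
  finally show ?thesis using R_xy finite_R by simp
qed

text \<open>Each vertex of \<open>A\<close> sends all its arcs to \<open>S\<close>, except possibly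
  one to \<open>y\<close>, and each vertex of \<open>S1\<close> receives just one of them.\<close>

lemma arcs_A_if_subset:
  assumes "A \<subseteq> B"
  shows "card A * (d - 1) \<le> card A * card S2 + card S1"
proof -
  have "card A * (d - 1) \<le> num_arcs E A S"
  proof (intro num_arcs_ge)
    fix a assume a: "a \<in> A"
    have "E `` {a} \<inter> V \<subseteq> insert y (E `` {a} \<inter> S)" using out_A[OF a] assms by auto
    then have "card (E `` {a} \<inter> V) \<le> card (insert y (E `` {a} \<inter> S))"
      using finite_sets by (intro card_mono) auto
    then have "d \<le> card (insert y (E `` {a} \<inter> S))" using outdeg[of a] A_facts[OF a] by simp
    then show "d - 1 \<le> card (E `` {a} \<inter> S)"
      using card_insert_le_m1[of "Suc (card (E `` {a} \<inter> S))" "E `` {a} \<inter> S" y] by simp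
  qed (use finite_sets in auto)
  also have "\<dots> \<le> num_arcs E A S2 + num_arcs E A S1"
  proof -
    have "S = S2 \<union> S1" unfolding S2_def S1_def by auto
    then show ?thesis by (metis num_arcs_Un_le)
  qed
  also have "num_arcs E A S1 \<le> card S1"
  proof -
    have "card (E\<inverse> `` {c} \<inter> A) = 1" if "c \<in> S1" for c
      using that unfolding S1_def by auto
    then show ?thesis
      using num_arcs_eq_sum[of S1 A "E\<inverse>"] finite_sets by (simp add: num_arcs_converse)
  qed
  also have "num_arcs E A S2 \<le> card A * card S2" using finite_sets by (intro num_arcs_le)
  finally show ?thesis by simp
qed


text \<open>Otherwise \<open>card_V\<close> with \<open>card T\<close> replaced by
  \<open>card S2\<close> leaves too little room for the arcs out of \<open>A\<close> and
  \<open>S2\<close>.\<close>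

lemma card_S2_gt_card_T:
  assumes d: "2 * card V + 3 \<le> 7 * d" "6 \<le> d"
  shows "card T < card S2"
proof (rule ccontr)
  assume "\<not> card T < card S2"
  define k p s s1 r where "k = int (card A)" and "p = int (card (A - B))" and "s = int (card S2)"
    and "s1 = int (card S1)" and "r = int (card R)"
  note defs = k_def p_def s_def s1_def r_def
  define \<delta> where "\<delta> = int d"
  have "card (S1 \<union> {x, y}) \<le> card R"
    using S1_subset_R R_xy finite_R by (intro card_mono) auto
  moreover have "card (S1 \<union> {x, y}) = card S1 + card {x, y}"
    using S1_subset_R finite_sets by (intro card_Un_disjoint) auto
  ultimately have r: "s1 + 2 \<le> r" using x_y unfolding defs by simp
  have nonneg: "0 \<le> p" "0 \<le> s" "0 \<le> s1" "p \<le> k"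
    using finite_sets unfolding defs by (auto intro: card_mono)
  have k: "\<delta> - 1 \<le> k" "k \<le> \<delta>" "6 \<le> \<delta>"
    using card_A_le card_A_ge d unfolding defs \<delta>_def by auto
  have N: "2 * k + 2 * p + 4 * s + 2 * r + 3 \<le> 7 * \<delta>"
  proof -
    have "2 * k + 2 * p + 4 * s + 2 * r + 3 \<le> 2 * (k + p + s + int (card T) + r) + 3"
      using \<open>\<not> card T < card S2\<close> unfolding defs by simp
    also have "\<dots> = 2 * int (card V) + 3" using card_V unfolding defs by simp
    also have "\<dots> \<le> 7 * \<delta>" using d(1) unfolding \<delta>_def by linarith
    finally show ?thesis .
  qed
  define e where "e = int (num_arcs E S2 S2)"
  define f where "f = int (num_arcs E (A - B) S2)"
  define g where "g = int (num_arcs E S2 (A - B))"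
  define h where "h = int (num_arcs E (A - B) (A - B))"
  have e: "2 * e + s \<le> s * s"
    using of_nat_mono[where 'a = int, OF num_arcs_self_le[OF _ asym, of S2]] finite_sets
    unfolding e_def defs by simp
  have h: "2 * h + p \<le> p * p"
    using of_nat_mono[where 'a = int, OF num_arcs_self_le[OF _ asym, of "A - B"]] finite_sets
    unfolding h_def defs by simp
  have fg: "f + g \<le> p * s"
    using of_nat_mono[where 'a = int, OF num_arcs_swap_le[OF _ _ asym, of "A - B" S2]] finite_sets
    unfolding f_def g_def defs by simp
  have f_le: "f \<le> p * s"
    using of_nat_mono[where 'a = int, OF num_arcs_le[of "A - B" S2 E]] finite_sets
    unfolding f_def defs by simp
  have A': "p * \<delta> \<le> h + f"
    using of_nat_mono[where 'a = int, OF arcs_A_minus_B] unfolding defs h_def f_def \<delta>_def by simp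
  have S2': "s * \<delta> \<le> g + e + s * (r - 1)"
  proof -
    have "int (card R - 1) = r - 1" using r nonneg unfolding defs by linarith
    then show ?thesis
      using of_nat_mono[where 'a = int, OF arcs_S2] unfolding defs g_def e_def \<delta>_def by simp
  qed
  show False
  \<comment> \<open>If \<open>p = 0\<close>, then \<open>A = B\<close>; the count over
    \<open>A - B\<close> is void and \<open>arcs_A_if_subset\<close> takes its place.\<close>
  proof (cases "p = 0")
    case True
    then have "A \<subseteq> B" using finite_sets unfolding p_def by auto
    have "int (d - 1) = \<delta> - 1" using k unfolding \<delta>_def by linarith
    then have *: "k * (\<delta> - 1) \<le> k * s + s1"
      using of_nat_mono[where 'a = int, OF arcs_A_if_subset[OF \<open>A \<subseteq> B\<close>]] unfolding defs by simp
    show False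
    proof (cases "s1 < k")
      case True
      then have "k * (\<delta> - 1) < k * (s + 1)" using * by (simp add: algebra_simps)
      then have s: "\<delta> - 1 \<le> s" using k by (simp add: mult_less_cancel_left)
      have "g = 0" using \<open>A \<subseteq> B\<close> unfolding g_def num_arcs_def by (simp add: Diff_eq_empty_iff[THEN iffD2])
      then have "s * (2 * \<delta>) \<le> s * (s - 1 + 2 * (r - 1))"
        using S2' e by (simp add: algebra_simps)
      then have "2 * \<delta> + 3 \<le> s + 2 * r" using s k by simp
      then show False using N s k \<open>p = 0\<close> by linarith
    next
      case False
      have "k * (2 * s + s1) \<ge> k * (2 * \<delta> + k - 4)"
      proof -
        \<comment> \<open>This trades the \<open>2 * s1\<close> in twice \<open>*\<close> for
          \<open>k * s1\<close>, so that \<open>k\<close> cancels. With \<open>N\<close>,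
          \<open>r\<close> and \<open>\<delta> - 1 \<le> k\<close> the result gives
          \<open>8 * \<delta> - 5 \<le> 7 * \<delta>\<close>, which \<open>6 \<le> \<delta>\<close>
          excludes.\<close>
        have "(k - 2) * (s1 - k) \<ge> 0" using False k by (intro mult_nonneg_nonneg) auto
        then show ?thesis using * by (simp add: algebra_simps)
      qed
      then have "2 * s + s1 \<ge> 2 * \<delta> + k - 4" using k by simp
      then show False using N r k \<open>p = 0\<close> by linarith
    qed
  next
    case False
    then have p: "1 \<le> p" using nonneg by linarith
    have "p * (2 * \<delta> - p + 1) \<le> p * (2 * s)" using A' h f_le by (simp add: algebra_simps)
    then have s: "2 * \<delta> - p + 1 \<le> 2 * s" using p by simp
    \<comment> \<open>Arcs from \<open>A - B\<close> to \<open>S2\<close> block the opposite ones: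
      \<open>fg\<close> turns the lower bound on \<open>f\<close> from \<open>A'\<close> and
      \<open>h\<close> into an upper bound on \<open>g\<close>.\<close>
    have "s * (2 * \<delta> + 2 - 2 * p - 2 * r) \<le> s * (s - 1) - p * (2 * \<delta> - p + 1)"
      using S2' e fg A' h by (simp add: algebra_simps)
    moreover have "s * (4 * s + 3 - 3 * \<delta>) \<le> s * (2 * \<delta> + 2 - 2 * p - 2 * r)"
      using N k nonneg by (intro mult_left_mono) auto
    ultimately have 1: "s * (3 * s + 4 - 3 * \<delta>) + p * (2 * \<delta> - p + 1) \<le> 0"
      by (simp add: algebra_simps)
    \<comment> \<open>With \<open>\<delta>\<close> expressed by \<open>z\<close>, \<open>p\<close>
      and the slack \<open>c\<close>, four times the left side of \<open>1\<close> is
      \<open>z * (11 + p + 3 * c) - 4 * p * c\<close>. It increases in \<open>z\<close>, and at the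
      lower bound \<open>p + c\<close> the mixed terms cancel.\<close>
    define z c where "z = 2 * s" and "c = 2 * s - (2 * \<delta> - p + 1)"
    have c: "0 \<le> c" "z = 2 * \<delta> - p + 1 + c" using s unfolding c_def z_def by auto
    have z: "p + c \<le> z" using c k nonneg by linarith
    have "0 < 11 * p + 11 * c + p * p + 3 * (c * c)" using p c by (simp add: add_pos_nonneg)
    also have "\<dots> = (p + c) * (11 + p + 3 * c) - 4 * p * c" by (simp add: algebra_simps)
    also have "\<dots> \<le> z * (11 + p + 3 * c) - 4 * p * c"
      using z p c by (intro diff_right_mono mult_right_mono) auto
    also have "\<dots> = 4 * (s * (3 * s + 4 - 3 * \<delta>) + p * (2 * \<delta> - p + 1))"
      unfolding c_def z_def by (simp add: algebra_simps)
    finally show False using 1 by simp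
  qed
qed

text \<open>Reversal swaps \<open>S\<close> and \<open>T\<close>, so
  \<open>card_S2_gt_card_T\<close> and its mirror image make each of \<open>S\<close> and
  \<open>T\<close> larger than the other.\<close>

lemma inconsistent:
  assumes "2 * card V + 3 \<le> 7 * d" "6 \<le> d"
  shows False
proof -
  interpret rev: no_short_path V "E\<inverse>" y x B A d by (rule rev)
  have "rev.S = T" "rev.T = S" by (auto simp: rev.S_def T_def rev.T_def S_def)
  then have "card S < card rev.S2" using rev.card_S2_gt_card_T[OF assms] by simp
  also have "\<dots> \<le> card T"
    using finite_sets by (intro card_mono) (auto simp: rev.S2_def \<open>rev.S = T\<close>)
  also have "\<dots> < card S2" by (rule card_S2_gt_card_T[OF assms])
  also have "\<dots> \<le> card S" using finite_sets by (intro card_mono) (auto simp: S2_def)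
  finally show False by simp
qed

end

section \<open>Existence of a path of length 3 to 5\<close>

lemma ex_path_of_length_3_to_5:
  fixes E :: "'a rel"
  assumes "finite V" "x \<in> V" "y \<in> V" "x \<noteq> y"
    and asym: "\<And>u v. (u, v) \<in> E \<Longrightarrow> (v, u) \<notin> E"
    and outdeg: "\<And>u. u \<in> V \<Longrightarrow> d \<le> card (E `` {u} \<inter> V)"
    and indeg: "\<And>u. u \<in> V \<Longrightarrow> d \<le> card (E\<inverse> `` {u} \<inter> V)"
    and d: "2 * card V + 3 \<le> 7 * d" "6 \<le> d"
  shows "\<exists>zs. length zs \<in> {2, 3, 4} \<and> set zs \<subseteq> V \<and> distinct (x # zs @ [y]) \<and>
    successively (\<lambda>u v. (u, v) \<in> E) (x # zs @ [y])"
proof (rule ccontr)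
  assume "\<not> ?thesis"
  then have no_path: False if "length zs \<in> {2, 3, 4}" "set zs \<subseteq> V" "distinct (x # zs @ [y])"
    "successively (\<lambda>u v. (u, v) \<in> E) (x # zs @ [y])" for zs using that by blast
  have irrefl: "(u, u) \<notin> E" for u using asym by blast
  define A0 where "A0 = E `` {x} \<inter> V - {y}"
  define B0 where "B0 = E\<inverse> `` {y} \<inter> V - {x}"
  \<comment> \<open>An arc from \<open>x\<close> to \<open>y\<close> costs \<open>A0\<close> and
    \<open>B0\<close> one vertex each.\<close>
  define k where "k = (if (x, y) \<in> E then d - 1 else d)"
  have fin: "finite A0" "finite B0" using \<open>finite V\<close> by (auto simp: A0_def B0_def)
  have k: "k \<le> card A0" "k \<le> card B0"
    using outdeg[OF \<open>x \<in> V\<close>] indeg[OF \<open>y \<in> V\<close>] \<open>x \<in> V\<close> \<open>y \<in> V\<close>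
    unfolding k_def A0_def B0_def by auto
  \<comment> \<open>With \<open>k\<close> common vertices choose \<open>A = B\<close>; otherwise let
    both sets contain \<open>A0 \<inter> B0\<close>.\<close>
  obtain A B where AB: "A \<subseteq> A0" "B \<subseteq> B0" "card A = k" "card B = k"
    "(A - B) \<inter> B0 = {}" "(B - A) \<inter> A0 = {}"
  proof (cases "k \<le> card (A0 \<inter> B0)")
    case True
    then obtain D where "D \<subseteq> A0 \<inter> B0" "card D = k" by (meson obtain_subset_with_card_n)
    then show ?thesis using that[of D D] by auto
  next
    case False
    then have "card (A0 \<inter> B0) \<le> k" by simp
    then obtain A B where "A0 \<inter> B0 \<subseteq> A" "A \<subseteq> A0" "card A = k" "A0 \<inter> B0 \<subseteq> B" "B \<subseteq> B0" "card B = k"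
      using exists_subset_between[of "A0 \<inter> B0" k A0] exists_subset_between[of "A0 \<inter> B0" k B0] k fin
      by (metis Int_lower1 Int_lower2)
    then show ?thesis using that[of A B] by auto
  qed
  have "no_short_path V E x y A B d"
  proof unfold_locales
    show "d \<le> card A + 1" "card A \<le> d" using AB by (auto simp: k_def)
    show "(a, y) \<notin> E" if "a \<in> A - B" for a
      using AB(1,5) that irrefl unfolding A0_def B0_def by blast
    show "(x, b) \<notin> E" if "b \<in> B - A" for b
      using AB(2,6) that irrefl unfolding A0_def B0_def by blast
    show False if "(x, a) \<in> E" "(a, b) \<in> E" "(b, y) \<in> E" "{a, b} \<subseteq> V - {x, y}" for a b
      using no_path[of "[a, b]"] that irrefl \<open>x \<noteq> y\<close> by auto
    show False if "(x, a) \<in> E" "(a, c) \<in> E" "(c, b) \<in> E" "(b, y) \<in> E"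
      "{a, c, b} \<subseteq> V - {x, y}" for a c b
      using no_path[of "[a, c, b]"] that irrefl asym \<open>x \<noteq> y\<close> by auto
    \<comment> \<open>Vertices two steps apart differ by \<open>asym\<close>; only \<open>a\<close>
      and \<open>b\<close> could coincide.\<close>
    show False if "(x, a) \<in> E" "(a, c) \<in> E" "(c, c') \<in> E" "(c', b) \<in> E" "(b, y) \<in> E"
      "{a, c, c', b} \<subseteq> V - {x, y}" "a \<noteq> b" for a c c' b
      using no_path[of "[a, c, c', b]"] that irrefl asym \<open>x \<noteq> y\<close> by auto
  qed (use assms AB in \<open>auto simp: A0_def B0_def\<close>)
  then show False using d by (rule no_short_path.inconsistent)
qed


section \<open>Building the cycle\<close>

lemma transitive_triangle:
  fixes E :: "'a rel"
  assumes "finite V" and E: "E \<subseteq> V \<times> V" and "u \<in> V"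
    and asym: "\<And>u v. (u, v) \<in> E \<Longrightarrow> (v, u) \<notin> E"
    and outdeg: "\<And>u. u \<in> V \<Longrightarrow> card V < 3 * card (E `` {u})"
    and indeg: "\<And>u. u \<in> V \<Longrightarrow> card V < 3 * card (E\<inverse> `` {u})"
  obtains q r where "(u, q) \<in> E" "(q, r) \<in> E" "(u, r) \<in> E"
proof -
  have "E `` {u} \<noteq> {}" using outdeg[OF \<open>u \<in> V\<close>] by auto
  then obtain w where w: "(u, w) \<in> E" "w \<in> V" using E by auto
  \<comment> \<open>Whichever way the arc between \<open>w\<close> and \<open>z\<close> points,
    \<open>u\<close> is the source of the triangle.\<close>
  have "\<exists>z. (u, z) \<in> E \<and> ((w, z) \<in> E \<or> (z, w) \<in> E)"
  proof (rule ccontr)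
    assume "\<not> ?thesis"
    then have disj: "E `` {u} \<inter> (E `` {w} \<union> E\<inverse> `` {w}) = {}" "E `` {w} \<inter> E\<inverse> `` {w} = {}"
      using asym by auto
    have fin: "finite (E `` {v})" "finite (E\<inverse> `` {v})" for v
      using \<open>finite V\<close> E by (auto intro: finite_subset[of _ V])
    have "card (E `` {u}) + (card (E `` {w}) + card (E\<inverse> `` {w}))
        = card (E `` {u} \<union> (E `` {w} \<union> E\<inverse> `` {w}))"
      using disj fin by (simp add: card_Un_disjoint)
    also have "\<dots> \<le> card V" using \<open>finite V\<close> E by (intro card_mono) auto
    finally show False using outdeg[OF \<open>u \<in> V\<close>] outdeg[OF \<open>w \<in> V\<close>] indeg[OF \<open>w \<in> V\<close>] by linarith
  qed
  then show ?thesis using that w(1) by blast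
qed

text \<open>Each step adds one vertex to \<open>F\<close> and lowers \<open>j\<close> by one, so
  \<open>card F + j\<close> never grows.\<close>

lemma greedy_path:
  fixes E :: "'a rel"
  assumes "finite V" and E: "E \<subseteq> V \<times> V" and "u \<in> V" and "finite F"
    and outdeg: "\<And>u. u \<in> V \<Longrightarrow> card F + j < card (E `` {u})"
  shows "\<exists>ws. length ws = j \<and> set ws \<subseteq> V - F \<and> distinct (u # ws) \<and>
    successively (\<lambda>u v. (u, v) \<in> E) (u # ws)"
  using assms(3-)
proof (induction j arbitrary: u F)
  case (Suc j)
  have "\<not> E `` {u} \<subseteq> insert u F"
  proof
    assume "E `` {u} \<subseteq> insert u F"
    then have "card (E `` {u}) \<le> card (insert u F)" using Suc.prems by (intro card_mono) auto
    then show False using Suc.prems(3)[OF \<open>u \<in> V\<close>] card_insert_le_m1[of "Suc (card F)" F u] by simp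
  qed
  then obtain w where w: "(u, w) \<in> E" "w \<noteq> u" "w \<notin> F" "w \<in> V" using E by auto
  have "card (insert u F) \<le> card F + 1" by (simp add: card_insert_le_m1)
  then have "card (insert u F) + j < card (E `` {v})" if "v \<in> V" for v
    using Suc.prems(3)[OF that] by linarith
  from Suc.IH[OF \<open>w \<in> V\<close> _ this] obtain ws where "length ws = j" "set ws \<subseteq> V - insert u F"
    "distinct (w # ws)" "successively (\<lambda>u v. (u, v) \<in> E) (w # ws)" using \<open>finite F\<close> by auto
  then show ?case using w by (intro exI[of _ "w # ws"]) auto
qed simp

lemma ex_cycle_through:
  fixes E :: "'a rel"
  assumes "finite V" and E: "E \<subseteq> V \<times> V" and "v \<in> V"
    and asym: "\<And>u v. (u, v) \<in> E \<Longrightarrow> (v, u) \<notin> E"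
    and outdeg: "\<And>u. u \<in> V \<Longrightarrow> card V div 3 + 1 \<le> card (E `` {u})"
    and indeg: "\<And>u. u \<in> V \<Longrightarrow> card V div 3 + 1 \<le> card (E\<inverse> `` {u})"
    and l: "7 \<le> l" "15 * l - 60 \<le> card V"
  shows "\<exists>xs. length (v # xs) = l \<and> distinct (v # xs) \<and>
    successively (\<lambda>u v. (u, v) \<in> E) (v # xs @ [v])"
proof -
  have irrefl: "(u, u) \<notin> E" for u using asym by blast
  have tri: "\<exists>q r. (u, q) \<in> E \<and> (q, r) \<in> E \<and> (u, r) \<in> E" if "u \<in> V" for u
  proof -
    have "card V < 3 * m" if "card V div 3 + 1 \<le> m" for m using that by linarith
    then show ?thesis
      using transitive_triangle[OF \<open>finite V\<close> E \<open>u \<in> V\<close> asym] outdeg indeg by metis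
  qed
  obtain q r where qr: "(v, q) \<in> E" "(q, r) \<in> E" "(v, r) \<in> E" using tri \<open>v \<in> V\<close> by blast
  then have "r \<in> V" using E by auto
  then obtain q' r' where qr': "(r, q') \<in> E" "(q', r') \<in> E" "(r, r') \<in> E" using tri by blast
  have in_V: "q \<in> V" "r \<in> V" "q' \<in> V" "r' \<in> V" using qr qr' E by auto
  have distinct: "distinct [v, q, r, q', r']" using qr qr' asym irrefl by auto
  obtain ws where ws: "length ws = l - 7" "set ws \<subseteq> V - {v, q, r, q'}" "distinct (r' # ws)"
    "successively (\<lambda>u v. (u, v) \<in> E) (r' # ws)"
  proof -
    have "card {v, q, r, q'} + (l - 7) < card (E `` {u})" if "u \<in> V" for u
    proof -
      have "card {v, q, r, q'} = 4" using distinct by simp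
      then show ?thesis using outdeg[OF that] l by linarith
    qed
    then show ?thesis
      using greedy_path[OF \<open>finite V\<close> E \<open>r' \<in> V\<close>, of "{v, q, r, q'}" "l - 7"] that by blast
  qed
  define x where "x = last (r' # ws)"
  \<comment> \<open>\<open>x\<close> stays available as the start of the closing path; for
    \<open>l = 7\<close> it is \<open>r'\<close> itself.\<close>
  define F where "F = {q, r, q', r'} \<union> set ws - {x}"
  have x: "x \<in> {r'} \<union> set ws" unfolding x_def by auto
  then have "x \<in> V" "x \<noteq> v" using in_V ws(2) distinct by auto
  have card_F: "card F = l - 4"
  proof -
    have "set (q # r # q' # r' # ws) = {q, r, q', r'} \<union> set ws" by auto
    moreover have "distinct (q # r # q' # r' # ws)" using distinct ws(2,3) by auto
    ultimately have "card ({q, r, q', r'} \<union> set ws) = 4 + (l - 7)"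
      using ws(1) by (metis distinct_card length_Cons add_Suc add_0 numeral_eq_Suc pred_numeral_simps BitM.simps)
    then show ?thesis using x l unfolding F_def by (subst card_Diff_singleton) auto
  qed
  define H where "H = V - F"
  have H: "finite H" "x \<in> H" "v \<in> H"
    using \<open>finite V\<close> \<open>x \<in> V\<close> \<open>v \<in> V\<close> distinct ws(2) unfolding H_def F_def by auto
  have "finite F" "F \<subseteq> V" using ws(2) in_V unfolding F_def by auto
  then have card_H: "card H = card V - (l - 4)"
    unfolding H_def using card_F by (simp add: card_Diff_subset)
  define d where "d = card V div 3 + 1 - (l - 4)"
  have deg: "d \<le> card (N \<inter> H)" if "N \<subseteq> V" "card V div 3 + 1 \<le> card N" for N
  proof -
    have "N \<inter> H = N - F" using that unfolding H_def by auto
    then show ?thesis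
      using that card_F diff_card_le_card_Diff[of F N] \<open>finite F\<close> unfolding d_def by simp
  qed
  have "d \<le> card (E `` {u} \<inter> H)" "d \<le> card (E\<inverse> `` {u} \<inter> H)" if "u \<in> H" for u
    using E outdeg[of u] indeg[of u] that deg[of "E `` {u}"] deg[of "E\<inverse> `` {u}"]
    by (auto simp: H_def)
  \<comment> \<open>With \<open>m = card V div 3\<close>, so \<open>card V \<le> 3 * m + 2\<close>,
    the first bound follows from \<open>5 * (l - 4) \<le> m\<close>; hence the threshold
    \<open>15 * l - 60\<close>.\<close>
  moreover have "2 * card H + 3 \<le> 7 * d" "6 \<le> d"
    using l unfolding card_H d_def by linarith+
  ultimately obtain zs where zs: "length zs \<in> {2, 3, 4}" "set zs \<subseteq> H" "distinct (x # zs @ [v])"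
    "successively (\<lambda>u v. (u, v) \<in> E) (x # zs @ [v])"
    using ex_path_of_length_3_to_5[OF H \<open>x \<noteq> v\<close> asym, of d] by blast
  \<comment> \<open>The three pieces have \<open>length gs + 1\<close>, \<open>l - 7\<close> and
    \<open>length zs + 1\<close> arcs; the total is \<open>l\<close> exactly when the lengths sum to
    5.\<close>
  obtain gs where gs: "length gs + length zs = 5" "set gs \<subseteq> {q, r, q'}" "distinct gs"
    "successively (\<lambda>u v. (u, v) \<in> E) (v # gs @ [r'])"
  proof -
    from zs(1) consider "length zs = 4" | "length zs = 3" | "length zs = 2" by auto
    then show ?thesis
    proof cases
      case 1
      show ?thesis by (rule that[of "[r]"]) (use 1 qr qr' distinct in auto)
    next
      case 2
      show ?thesis by (rule that[of "[q, r]"]) (use 2 qr qr' distinct in auto)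
    next
      case 3
      show ?thesis by (rule that[of "[q, r, q']"]) (use 3 qr qr' distinct in auto)
    qed
  qed
  have zs_disj: "set zs \<inter> ({v, q, r, q', r'} \<union> set ws) = {}"
    using zs(2,3) unfolding H_def F_def by auto
  have "distinct (v # gs @ (r' # ws) @ zs)"
    using zs_disj gs(2,3) ws(2,3) zs(3) distinct by auto
  moreover have "length (v # gs @ (r' # ws) @ zs) = l" using gs(1) ws(1) l by simp
  moreover have "successively (\<lambda>u v. (u, v) \<in> E) (v # (gs @ (r' # ws) @ zs) @ [v])"
  proof -
    have "successively (\<lambda>u v. (u, v) \<in> E) ((v # gs) @ (r' # ws) @ (zs @ [v]))"
      using gs(4) ws(4) zs(4) unfolding successively_append_iff
      by (auto simp: successively_append_iff successively_Cons x_def)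
    then show ?thesis by simp
  qed
  ultimately show ?thesis by blast
qed

section \<open>Transfer to digraphs and their walks\<close>

context oriented_graph
begin

text \<open>Degrees count arcs; without parallel arcs, distinct arcs out of \<open>u\<close> have
  distinct heads.\<close>

lemma card_out_neighbours: "card (arcs_ends G `` {u}) = out_degree G u"
proof -
  have "arcs_ends G `` {u} = head G ` out_arcs G u"
    by (force simp: arcs_ends_def arc_to_ends_def out_arcs_def)
  moreover have "inj_on (head G) (out_arcs G u)"
    using inj_on_arc_to_ends by (auto simp: inj_on_def arc_to_ends_def)
  ultimately show ?thesis by (simp add: out_degree_def card_image)
qed

lemma card_in_neighbours: "card ((arcs_ends G)\<inverse> `` {u}) = in_degree G u"
proof -
  have "(arcs_ends G)\<inverse> `` {u} = tail G ` in_arcs G u"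
    by (force simp: arcs_ends_def arc_to_ends_def in_arcs_def)
  moreover have "inj_on (tail G) (in_arcs G u)"
    using inj_on_arc_to_ends by (auto simp: inj_on_def arc_to_ends_def)
  ultimately show ?thesis by (simp add: in_degree_def card_image)
qed

lemma awalk_of_vertices:
  assumes "successively (\<lambda>u v. (u, v) \<in> arcs_ends G) (u # xs)" "u \<in> verts G"
  shows "\<exists>p. awalk u p (last (u # xs)) \<and> awalk_verts u p = u # xs"
  using assms
proof (induction xs arbitrary: u)
  case Nil
  then show ?case by (intro exI[of _ "[]"]) (simp add: awalk_Nil_iff)
next
  case (Cons w xs)
  then have "(u, w) \<in> arcs_ends G" by simp
  then obtain e where e: "e \<in> arcs G" "tail G e = u" "head G e = w"
    by (auto simp: arcs_ends_def arc_to_ends_def)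
  have "w \<in> verts G" using e by auto
  then obtain p where "awalk w p (last (w # xs))" "awalk_verts w p = w # xs"
    using Cons.IH[of w] Cons.prems by auto
  then show ?case using e by (intro exI[of _ "e # p"]) (auto simp: awalk_Cons_iff)
qed

lemma lies_on_directed_cycleI:
  assumes "successively (\<lambda>u v. (u, v) \<in> arcs_ends G) (v # xs @ [v])" "distinct (v # xs)"
    and "v \<in> verts G"
  shows "lies_on_directed_cycle G (length (v # xs)) v"
proof -
  obtain p where p: "awalk v p v" "awalk_verts v p = v # xs @ [v]"
    using awalk_of_vertices[of v "xs @ [v]"] assms by auto
  have len: "length p = length (v # xs)"
    using p(2) length_awalk_verts[of v p] by simp
  then obtain e es where "p = e # es" by (cases p) auto
  then have "tail G e = v" using p(1) by (auto simp: awalk_Cons_iff)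
  then have "v \<in> tail G ` set p" using \<open>p = e # es\<close> by auto
  \<comment> \<open>\<open>cycle\<close> wants the vertex list without its first entry to be
    distinct, here \<open>xs @ [v]\<close>.\<close>
  moreover have "cycle p" unfolding cycle_def using p len assms(2) by auto
  ultimately show ?thesis unfolding lies_on_directed_cycle_def using len by blast
qed

lemma min_semidegree_le:
  assumes "u \<in> verts G"
  shows "min_semidegree G \<le> out_degree G u" "min_semidegree G \<le> in_degree G u"
proof -
  have "min_semidegree G \<le> min (out_degree G u) (in_degree G u)"
    unfolding min_semidegree_def using assms by (intro Min_le) auto
  then show "min_semidegree G \<le> out_degree G u" "min_semidegree G \<le> in_degree G u" by auto
qed

end

theorem corollary2p7:
  fixes G :: "('a, 'b) pre_digraph" and l n :: nat
  assumes "l \<ge> 7"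
    and "n \<ge> 15 * l - 60"
    and "oriented_graph G"
    and "card (verts G) = n"
    and "min_semidegree G \<ge> n div 3 + 1"
  shows "\<forall>v \<in> verts G. lies_on_directed_cycle G l v"
proof
  fix v assume v: "v \<in> verts G"
  interpret oriented_graph G by fact
  have "arcs_ends G \<subseteq> verts G \<times> verts G"
    by (auto simp: arcs_ends_def arc_to_ends_def)
  moreover have "card (verts G) div 3 + 1 \<le> card (arcs_ends G `` {u})"
    "card (verts G) div 3 + 1 \<le> card ((arcs_ends G)\<inverse> `` {u})" if "u \<in> verts G" for u
    using min_semidegree_le[OF that] assms(4,5)
    by (auto simp: card_out_neighbours card_in_neighbours)
  moreover have "15 * l - 60 \<le> card (verts G)" using assms(2,4) by simp
  ultimately obtain xs where "length (v # xs) = l" "distinct (v # xs)"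
    "successively (\<lambda>u v. (u, v) \<in> arcs_ends G) (v # xs @ [v])"
    using ex_cycle_through[OF finite_verts _ v no_antiparallel_arcs _ _ \<open>l \<ge> 7\<close>] by blast
  then show "lies_on_directed_cycle G l v" using lies_on_directed_cycleI v by blast
qed

end
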